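(* Let $(S, *_h, *_v)$ be a double semigroup and let $(x_{ij})_{1\le i,j\le 4}$ be any sixteen elements of $S$. Put $R_i = x_{i1} *_h x_{i2} *_h x_{i3} *_h x_{i4}$ for $i=1,2,3,4$. Then $$R_1 *_v R_2 *_v R_3 *_v R_4 \;=\; R_1 *_v R_2 *_v R_3' *_v R_4, \qquad \text{where } R_3' = x_{31} *_h x_{33} *_h x_{32} *_h x_{34}.$$ That is, in a $4\times 4$ composite the two middle elements $a=x_{32}$, $b=x_{33}$ of the third row (counted from the bottom) may be interchanged, the other fourteen elements staying in place.
   Context: A double semigroup is a set $S$ equipped with two associative binary operations $*_h$ (horizontal) and $*_v$ (vertical), not assumed to have units, satisfying the interchange law $(x *_h y) *_v (z *_h w) = (x *_v z) *_h (y *_v w)$ for all $x,y,z,w\in S$. Graphically, $*_h$ is composition from left to right and $*_v$ is composition from bottom to top; in the $4\times4$ array, $x_{ij}$ is the entry in the $i$-th row from the bottom and the $j$-th column from the left. *)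

theory Defs
  imports Main
begin

text \<open>The underlying set is a whole type. The locale \<^locale>\<open>semigroup\<close> asks only for
  associativity, so no units are assumed.\<close>

locale double_semigroup =
  horizontal: semigroup hcomp + vertical: semigroup vcomp
  for hcomp :: "'a \<Rightarrow> 'a \<Rightarrow> 'a" (infixl "*\<^sub>h" 70)
    and vcomp :: "'a \<Rightarrow> 'a \<Rightarrow> 'a" (infixl "*\<^sub>v" 70) +
  assumes interchange: "(x *\<^sub>h y) *\<^sub>v (z *\<^sub>h w) = (x *\<^sub>v z) *\<^sub>h (y *\<^sub>v w)"

end

theory Submission
  imports Defs
begin

text \<open>
  Associativity allows the vertical cuts of adjacent rows to be shifted against each other, so an
  entry \<open>b\<close> strictly inside the third row can be pushed out of it into the fourth row. The result
  records only that \<open>b\<close> has left the row, not where it stood, so \<open>b\<close> can be reinserted on the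
  other side of its neighbour.
\<close>

context double_semigroup
begin

lemma slide_up:
  "(p *\<^sub>h q) *\<^sub>v (c *\<^sub>h b *\<^sub>h d) *\<^sub>v (u *\<^sub>h v *\<^sub>h w) =
    (p *\<^sub>h q) *\<^sub>v (c *\<^sub>h d) *\<^sub>v (u *\<^sub>h (b *\<^sub>v v) *\<^sub>h w)"
proof -
  have "(p *\<^sub>h q) *\<^sub>v (c *\<^sub>h b *\<^sub>h d) *\<^sub>v (u *\<^sub>h v *\<^sub>h w) =
      (p *\<^sub>v ((c *\<^sub>h b) *\<^sub>v (u *\<^sub>h v))) *\<^sub>h ((q *\<^sub>v d) *\<^sub>v w)"
    by (simp only: interchange vertical.assoc)
  \<comment> \<open>Cutting the left column above \<open>p\<close> but the right one above
    \<open>d\<close> puts \<open>b\<close> in the upper block and \<open>d\<close> in the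
    lower.\<close>
  also have "\<dots> = (p *\<^sub>h (q *\<^sub>v d)) *\<^sub>v (((c *\<^sub>h b) *\<^sub>v (u *\<^sub>h v)) *\<^sub>h w)"
    by (rule interchange [symmetric])
  \<comment> \<open>With \<open>d\<close> out of the way, the vertical cut can pass from the right
    of \<open>b\<close> to its left.\<close>
  also have "((c *\<^sub>h b) *\<^sub>v (u *\<^sub>h v)) *\<^sub>h w = (c *\<^sub>v u) *\<^sub>h ((b *\<^sub>v v) *\<^sub>h w)"
    by (simp only: interchange horizontal.assoc)
  also have "(p *\<^sub>h (q *\<^sub>v d)) *\<^sub>v \<dots> =
      ((p *\<^sub>v c) *\<^sub>v u) *\<^sub>h ((q *\<^sub>v d) *\<^sub>v ((b *\<^sub>v v) *\<^sub>h w))"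
    by (simp only: interchange vertical.assoc)
  also have "\<dots> = (p *\<^sub>h q) *\<^sub>v (c *\<^sub>h d) *\<^sub>v (u *\<^sub>h ((b *\<^sub>v v) *\<^sub>h w))"
    by (simp only: interchange)
  finally show ?thesis
    by (simp only: horizontal.assoc)
qed

text \<open>Sliding \<open>b\<close> up from either side of \<open>a\<close> leaves the same third
  row, c a d, and the same fourth row.\<close>

lemma swap_inner:
  "(p *\<^sub>h q) *\<^sub>v (c *\<^sub>h a *\<^sub>h b *\<^sub>h d) *\<^sub>v (u *\<^sub>h v *\<^sub>h w) =
    (p *\<^sub>h q) *\<^sub>v (c *\<^sub>h b *\<^sub>h a *\<^sub>h d) *\<^sub>v (u *\<^sub>h v *\<^sub>h w)"
  using slide_up [of p q "c *\<^sub>h a" b d u v w] slide_up [of p q c b "a *\<^sub>h d" u v w]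
  by (simp only: horizontal.assoc)

end

theorem proposition2p3:
  fixes hcomp :: "'a \<Rightarrow> 'a \<Rightarrow> 'a" (infixl "*\<^sub>h" 70)
    and vcomp :: "'a \<Rightarrow> 'a \<Rightarrow> 'a" (infixl "*\<^sub>v" 70)
    and x :: "nat \<Rightarrow> nat \<Rightarrow> 'a"
  assumes "double_semigroup hcomp vcomp"
  shows "let R = (\<lambda>i. x i 1 *\<^sub>h x i 2 *\<^sub>h x i 3 *\<^sub>h x i 4);
             R3' = x 3 1 *\<^sub>h x 3 3 *\<^sub>h x 3 2 *\<^sub>h x 3 4
         in R 1 *\<^sub>v R 2 *\<^sub>v R 3 *\<^sub>v R 4 = R 1 *\<^sub>v R 2 *\<^sub>v R3' *\<^sub>v R 4"
proof -
  interpret double_semigroup hcomp vcomp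
    by (fact assms)
  \<comment> \<open>The two bottom rows merge into one row with a single cut, serving as
    \<open>p\<close> and \<open>q\<close> in \<open>swap_inner\<close>; the cut before the last
    column is one choice among several.\<close>
  have R12: "(x 1 1 *\<^sub>h x 1 2 *\<^sub>h x 1 3 *\<^sub>h x 1 4) *\<^sub>v (x 2 1 *\<^sub>h x 2 2 *\<^sub>h x 2 3 *\<^sub>h x 2 4) =
      ((x 1 1 *\<^sub>h x 1 2 *\<^sub>h x 1 3) *\<^sub>v (x 2 1 *\<^sub>h x 2 2 *\<^sub>h x 2 3)) *\<^sub>h (x 1 4 *\<^sub>v x 2 4)"
    by (rule interchange)
  show ?thesis
    unfolding Let_def R12
    using swap_inner [of _ _ "x 3 1" "x 3 2" "x 3 3" "x 3 4" "x 4 1" "x 4 2" "x 4 3 *\<^sub>h x 4 4"]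
    by (simp only: horizontal.assoc)
qed

end
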